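(* Let $N=\{u_1,\dots,u_n\}$ be a finite ground set whose elements arrive in a stream in the order $u_1,\dots,u_n$, let $f:2^N\to\mathbb{R}_{\ge 0}$ be a non-negative (not necessarily monotone) submodular function accessed through a value oracle, let $k\ge 1$ be an integer, and let $\mathrm{OPT}=\max\{f(S): S\subseteq N,\ |S|\le k\}$. Suppose the input $v$ satisfies $\alpha\,\mathrm{OPT}\le v\le \mathrm{OPT}$ for some $\alpha\in(0,1]$. Then the algorithm $\mathcal{A}_1(v)$ described in the context (with the unconstrained subroutine being a deterministic $1/2$-approximation algorithm for unconstrained non-negative submodular maximization) satisfies: (i) it outputs a set $S$ with $|S|\le k$ and $f(S)\ge \frac{\alpha}{6}\mathrm{OPT}$; (ii) it makes 1 pass over the data set, stores at most $k$ elements, and has $O(1)$ query complexity per element.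
   Context: Notation: $f(u\mid T)=f(T\cup\{u\})-f(T)$. Submodularity: $f(S)+f(T)\ge f(S\cup T)+f(S\cap T)$ for all $S,T\subseteq N$. Unconstrained subroutine: $\mathrm{Unconstrained}(A)$ is a deterministic algorithm that, given $A\subseteq N$, returns a set $T\subseteq A$ with $f(T)\ge \frac12\max_{T'\subseteq A} f(T')$. Algorithm $\mathcal{A}_1(v)$: initialize $S_1=S_2=\emptyset$ and set $\tau=v/6$. For $j=1,\dots,n$, when $u_j$ arrives: if $f(u_j\mid S_1)\ge \tau/k$ and $|S_1|<k$, add $u_j$ to $S_1$; else if $f(u_j\mid S_2)\ge \tau/k$ and $|S_2|<k$, add $u_j$ to $S_2$; otherwise discard $u_j$. After the stream ends, set $S_3=\mathrm{Unconstrained}(S_1)$ and return $S=\arg\max\{f(S_1),f(S_2),f(S_3)\}$.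
   Formalization: "Stores at most k elements" is false for S1 and S2 together (f = card, two elements, k = v = 1 stores 2); proved instead: each of S1, S2 has at most k elements, at most 2k in total. The queries of Unconstrained after the stream are not charged to elements. *)

theory Defs
  imports Complex_Main
begin

definition submodular_on :: "'a set \<Rightarrow> ('a set \<Rightarrow> real) \<Rightarrow> bool" where
  "submodular_on N f \<longleftrightarrow>
     (\<forall>S T. S \<subseteq> N \<and> T \<subseteq> N \<longrightarrow> f S + f T \<ge> f (S \<union> T) + f (S \<inter> T))"

definition opt_value :: "'a set \<Rightarrow> ('a set \<Rightarrow> real) \<Rightarrow> nat \<Rightarrow> real" where
  "opt_value N f k = Max {f S | S. S \<subseteq> N \<and> card S \<le> k}"

(* A deterministic computation that has access to a set function only through
   value queries: a query node names a set and continues with the answer. *)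

datatype ('a, 'r) oracle_prog =
    Return 'r
  | Query "'a set" "real \<Rightarrow> ('a, 'r) oracle_prog"

primrec oracle_bind ::
  "('a, 'r) oracle_prog \<Rightarrow> ('r \<Rightarrow> ('a, 't) oracle_prog) \<Rightarrow> ('a, 't) oracle_prog"
  (infixl "\<bind>\<^sub>q" 54) where
  "Return r \<bind>\<^sub>q g = g r"
| "Query X c \<bind>\<^sub>q g = Query X (\<lambda>y. c y \<bind>\<^sub>q g)"

primrec result :: "('a set \<Rightarrow> real) \<Rightarrow> ('a, 'r) oracle_prog \<Rightarrow> 'r" where
  "result f (Return r) = r"
| "result f (Query X c) = result f (c (f X))"

primrec queries :: "('a set \<Rightarrow> real) \<Rightarrow> ('a, 'r) oracle_prog \<Rightarrow> nat" where
  "queries f (Return r) = 0"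
| "queries f (Query X c) = Suc (queries f (c (f X)))"

(* A streaming algorithm retains only its state of type 's between arrivals.
   At the end of a pass it either asks for a further pass (Inl) or outputs (Inr). *)

record ('a, 's) streaming_alg =
  start :: 's
  on_element :: "'a \<Rightarrow> 's \<Rightarrow> ('a, 's) oracle_prog"
  on_end :: "'s \<Rightarrow> ('a, 's + 'a set) oracle_prog"

definition state_after ::
  "('a, 's) streaming_alg \<Rightarrow> ('a set \<Rightarrow> real) \<Rightarrow> 'a list \<Rightarrow> 's \<Rightarrow> 's" where
  "state_after A f us s = fold (\<lambda>u s. result f (on_element A u s)) us s"

(* run_from A f us s ps S: started in state s, the algorithm terminates with output S,
   and ps lists the states at the beginning of the successive passes over us. *)

inductive run_from ::
  "('a, 's) streaming_alg \<Rightarrow> ('a set \<Rightarrow> real) \<Rightarrow> 'a list \<Rightarrow> 's \<Rightarrow> 's list \<Rightarrow> 'a set \<Rightarrow> bool"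
  for A f us where
  halt: "result f (on_end A (state_after A f us s)) = Inr S \<Longrightarrow> run_from A f us s [s] S"
| again: "result f (on_end A (state_after A f us s)) = Inl s' \<Longrightarrow> run_from A f us s' ps S
    \<Longrightarrow> run_from A f us s (s # ps) S"

definition run ::
  "('a, 's) streaming_alg \<Rightarrow> ('a set \<Rightarrow> real) \<Rightarrow> 'a list \<Rightarrow> 's list \<Rightarrow> 'a set \<Rightarrow> bool" where
  "run A f us ps S \<longleftrightarrow> run_from A f us (start A) ps S"

definition visited_states ::
  "('a, 's) streaming_alg \<Rightarrow> ('a set \<Rightarrow> real) \<Rightarrow> 'a list \<Rightarrow> 's list \<Rightarrow> 's set" where
  "visited_states A f us ps =
     {state_after A f (take i us) s | i s. i \<le> length us \<and> s \<in> set ps}"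

definition element_queries ::
  "('a, 's) streaming_alg \<Rightarrow> ('a set \<Rightarrow> real) \<Rightarrow> 'a list \<Rightarrow> 's list \<Rightarrow> nat \<Rightarrow> nat" where
  "element_queries A f us ps i =
     (\<Sum>s\<leftarrow>ps. queries f (on_element A (us ! i) (state_after A f (take i us) s)))"

definition end_queries ::
  "('a, 's) streaming_alg \<Rightarrow> ('a set \<Rightarrow> real) \<Rightarrow> 'a list \<Rightarrow> 's list \<Rightarrow> nat" where
  "end_queries A f us ps = (\<Sum>s\<leftarrow>ps. queries f (on_end A (state_after A f us s)))"

definition half_approx_unconstrained ::
  "'a set \<Rightarrow> ('a set \<Rightarrow> real) \<Rightarrow> ('a set \<Rightarrow> ('a, 'a set) oracle_prog) \<Rightarrow> bool" where
  "half_approx_unconstrained N f U \<longleftrightarrow>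
     (\<forall>A. A \<subseteq> N \<longrightarrow>
        result f (U A) \<subseteq> A \<and> f (result f (U A)) \<ge> 1 / 2 * Max (f ` Pow A))"

definition marginal :: "'a \<Rightarrow> 'a set \<Rightarrow> ('a, real) oracle_prog" where
  "marginal u T = Query (T \<union> {u}) (\<lambda>x. Query T (\<lambda>y. Return (x - y)))"

definition alg1_element ::
  "nat \<Rightarrow> real \<Rightarrow> 'a \<Rightarrow> 'a set \<times> 'a set \<Rightarrow> ('a, 'a set \<times> 'a set) oracle_prog" where
  "alg1_element k \<tau> u = (\<lambda>(S1, S2).
     marginal u S1 \<bind>\<^sub>q (\<lambda>m1.
       if m1 \<ge> \<tau> / real k \<and> card S1 < k then Return (S1 \<union> {u}, S2)
       else marginal u S2 \<bind>\<^sub>q (\<lambda>m2.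
         if m2 \<ge> \<tau> / real k \<and> card S2 < k then Return (S1, S2 \<union> {u})
         else Return (S1, S2))))"

(* Ties in the arg max are resolved in the order S1, S2, S3. *)

definition alg1_end ::
  "('a set \<Rightarrow> ('a, 'a set) oracle_prog) \<Rightarrow> 'a set \<times> 'a set
     \<Rightarrow> ('a, 'a set \<times> 'a set + 'a set) oracle_prog" where
  "alg1_end U = (\<lambda>(S1, S2).
     U S1 \<bind>\<^sub>q (\<lambda>S3. Query S1 (\<lambda>y1. Query S2 (\<lambda>y2. Query S3 (\<lambda>y3.
       Return (Inr (if y1 \<ge> y2 \<and> y1 \<ge> y3 then S1 else if y2 \<ge> y3 then S2 else S3)))))))"

(* The state is the pair (S1, S2) of candidate sets. Each has at most k elements, but
   their union can have 2 * k: take f = card on two elements, k = 1, v = 1. *)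

definition alg1 ::
  "('a set \<Rightarrow> ('a, 'a set) oracle_prog) \<Rightarrow> nat \<Rightarrow> real \<Rightarrow> ('a, 'a set \<times> 'a set) streaming_alg" where
  "alg1 U k v =
     \<lparr>start = ({}, {}), on_element = alg1_element k (v / 6), on_end = alg1_end U\<rparr>"

end

theory Submission imports Defs begin

text \<open>
  If one of the candidates fills up, its \<open>k\<close> accepted marginals already sum to \<open>\<tau> = v / 6\<close>.
  Otherwise every rejection is due to a small marginal, so for an optimal set \<open>Q\<close>
  submodularity gives \<open>f (S1 \<union> Q) \<le> f S1 + \<tau>\<close> and
  \<open>f (S2 \<union> (Q - S1)) \<le> f S2 + \<tau>\<close>. As \<open>S1\<close> and \<open>S2\<close> are disjoint, these two sets
  meet in \<open>Q - S1\<close>, hence \<open>f (Q - S1) \<le> f S1 + f S2 + 2 * \<tau>\<close>. The remaining part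
  \<open>Q \<inter> S1\<close> is covered by the unconstrained subroutine, \<open>f (Q \<inter> S1) \<le> 2 * f S3\<close>, so
  \<open>OPT \<le> f (Q - S1) + f (Q \<inter> S1) \<le> 4 * f S + OPT / 3\<close>.
\<close>

lemma result_bind [simp]: "result f (p \<bind>\<^sub>q g) = result f (g (result f p))"
  by (induction p) auto

lemma queries_bind [simp]:
  "queries f (p \<bind>\<^sub>q g) = queries f p + queries f (g (result f p))"
  by (induction p) auto

lemma result_marginal [simp]: "result f (marginal u T) = f (insert u T) - f T"
  by (simp add: marginal_def)

lemma queries_marginal [simp]: "queries f (marginal u T) = 2"
  by (simp add: marginal_def)

lemma submodular_onD:
  assumes "submodular_on N f" "S \<subseteq> N" "T \<subseteq> N"
  shows "f (S \<union> T) + f (S \<inter> T) \<le> f S + f T"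
  using assms unfolding submodular_on_def by blast

text \<open>Submodularity is applied to \<open>T\<close> and \<open>insert u S\<close>, which meet
  in \<open>S\<close> because \<open>u \<notin> T\<close>. For \<open>u \<in> T\<close> the left
  side would be 0 while the right side can be negative, as \<open>f\<close> need not be
  monotone.\<close>

lemma submodular_on_marginal_antimono:
  assumes "submodular_on N f" "S \<subseteq> T" "T \<subseteq> N" "u \<in> N" "u \<notin> T"
  shows "f (insert u T) - f T \<le> f (insert u S) - f S"
proof -
  have "f (T \<union> insert u S) + f (T \<inter> insert u S) \<le> f T + f (insert u S)"
    using assms by (intro submodular_onD[OF assms(1)]) auto
  moreover have "T \<union> insert u S = insert u T" "T \<inter> insert u S = S" using assms by auto
  ultimately show ?thesis by simp
qed

lemma submodular_on_union_le:
  assumes "submodular_on N f" "S \<subseteq> N" "T \<subseteq> N" "finite T"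
    and "\<And>u. u \<in> T \<Longrightarrow> f (insert u S) - f S \<le> \<theta>"
  shows "f (S \<union> T) \<le> f S + real (card T) * \<theta>"
  using assms(4,3,5)
proof (induction T rule: finite_induct)
  case (insert u T)
  have "f ((S \<union> T) \<union> insert u S) + f ((S \<union> T) \<inter> insert u S) \<le> f (S \<union> T) + f (insert u S)"
    using insert.prems assms(2) by (intro submodular_onD[OF assms(1)]) auto
  \<comment> \<open>The intersection is \<open>S\<close> even if \<open>u \<in> S\<close>, so
    \<open>T\<close> may overlap \<open>S\<close>.\<close>
  moreover have "(S \<union> T) \<union> insert u S = S \<union> insert u T" "(S \<union> T) \<inter> insert u S = S"
    using insert.hyps by auto
  moreover have "f (insert u S) - f S \<le> \<theta>" "f (S \<union> T) \<le> f S + real (card T) * \<theta>"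
    using insert by auto
  ultimately show ?case using insert.hyps by (simp add: algebra_simps)
qed simp

lemma opt_value_attained:
  assumes "finite N"
  obtains Q where "Q \<subseteq> N" "card Q \<le> k" "f Q = opt_value N f k"
proof -
  let ?V = "{f S | S. S \<subseteq> N \<and> card S \<le> k}"
  have "finite ?V"
    by (rule finite_subset[of _ "f ` Pow N"]) (use assms in auto)
  moreover have "f {} \<in> ?V" by force
  ultimately have "Max ?V \<in> ?V" by (intro Max_in) auto
  then show ?thesis using that unfolding opt_value_def by auto
qed

text \<open>
  \<open>threshold_set f k \<theta> A X\<close> describes the outcome of threshold greedy on the arrivals \<open>A\<close>.
  In the algorithm \<open>S1\<close> sees all arrivals, while \<open>S2\<close> only sees those that \<open>S1\<close> refused.
\<close>

definition threshold_set ::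
  "('a set \<Rightarrow> real) \<Rightarrow> nat \<Rightarrow> real \<Rightarrow> 'a set \<Rightarrow> 'a set \<Rightarrow> bool" where
  "threshold_set f k \<theta> A X \<longleftrightarrow>
     X \<subseteq> A \<and> card X \<le> k \<and> real (card X) * \<theta> \<le> f X \<and>
     (card X < k \<longrightarrow> (\<forall>u \<in> A - X. f (insert u X) - f X < \<theta>))"

text \<open>The accepted marginal pays for the larger cardinality, and earlier rejections stay
  justified because marginals only shrink as \<open>X\<close> grows.\<close>

lemma threshold_set_add:
  assumes "submodular_on N f" "threshold_set f k \<theta> A X" "finite A" "insert u A \<subseteq> N" "u \<notin> A"
    and "card X < k" "\<theta> \<le> f (insert u X) - f X"
  shows "threshold_set f k \<theta> (insert u A) (insert u X)"
proof -
  have X: "X \<subseteq> A" "u \<notin> X" "finite X"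
    using assms finite_subset unfolding threshold_set_def by auto
  have "f (insert w (insert u X)) - f (insert u X) < \<theta>" if "w \<in> A - X" for w
  proof -
    have "f (insert w (insert u X)) - f (insert u X) \<le> f (insert w X) - f X"
      using that X assms by (intro submodular_on_marginal_antimono[OF assms(1)]) auto
    then show ?thesis using assms(2,6) that unfolding threshold_set_def by force
  qed
  then show ?thesis using X assms unfolding threshold_set_def by (auto simp: algebra_simps)
qed

text \<open>Either the marginal of \<open>u\<close> is below \<open>\<theta>\<close>, or
  \<open>X\<close> is full and the clause on rejected elements is vacuous.\<close>

lemma threshold_set_reject:
  assumes "threshold_set f k \<theta> A X" "\<not> (\<theta> \<le> f (insert u X) - f X \<and> card X < k)"
  shows "threshold_set f k \<theta> (insert u A) X"
  using assms unfolding threshold_set_def by auto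

text \<open>Elements of \<open>T\<close> outside \<open>X\<close> were rejected for a small
  marginal; those inside have marginal 0, which is at most \<open>\<theta>\<close> since
  \<open>0 \<le> \<theta>\<close>. The same sign condition lets \<open>k\<close> replace
  \<open>card T\<close>.\<close>

lemma threshold_set_union_le:
  assumes "submodular_on N f" "threshold_set f k \<theta> A X" "A \<subseteq> N"
    and "card X < k" "T \<subseteq> A" "finite T" "card T \<le> k" "0 \<le> \<theta>"
  shows "f (X \<union> T) \<le> f X + real k * \<theta>"
proof -
  have "f (insert u X) - f X \<le> \<theta>" if "u \<in> T" for u
    using that assms by (cases "u \<in> X") (force simp: threshold_set_def insert_absorb)+
  moreover have "X \<subseteq> N" using assms unfolding threshold_set_def by auto
  ultimately have "f (X \<union> T) \<le> f X + real (card T) * \<theta>"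
    using assms by (intro submodular_on_union_le[OF assms(1)]) auto
  also have "\<dots> \<le> f X + real k * \<theta>"
    using assms by (intro add_left_mono mult_right_mono) auto
  finally show ?thesis .
qed

text \<open>The arrival set of \<open>S2\<close> depends on the current \<open>S1\<close>, so both
  claims are carried together. Induction from the end of the list isolates the last arrival.\<close>

lemma alg1_state_invariant:
  assumes "submodular_on N f" "0 \<le> f {}" "distinct us" "set us \<subseteq> N"
    and "state_after (alg1 U k v) f us ({}, {}) = (S1, S2)"
  shows "threshold_set f k (v / 6 / real k) (set us) S1 \<and>
    threshold_set f k (v / 6 / real k) (set us - S1) S2"
  using assms(3-)
proof (induction us arbitrary: S1 S2 rule: rev_induct)
  case Nil
  then show ?case using assms(2) by (simp add: state_after_def threshold_set_def)
next
  case (snoc u us)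
  let ?\<theta> = "v / 6 / real k"
  let ?accept = "\<lambda>X. ?\<theta> \<le> f (insert u X) - f X \<and> card X < k"
  obtain T1 T2 where T: "state_after (alg1 U k v) f us ({}, {}) = (T1, T2)" by fastforce
  with snoc have IH: "threshold_set f k ?\<theta> (set us) T1" "threshold_set f k ?\<theta> (set us - T1) T2"
    by auto
  have u: "u \<notin> set us" "insert u (set us) \<subseteq> N" using snoc.prems by auto
  have T1: "T1 \<subseteq> set us" using IH unfolding threshold_set_def by auto
  have step: "(S1, S2) = (if ?accept T1 then (insert u T1, T2)
      else if ?accept T2 then (T1, insert u T2) else (T1, T2))"
    using snoc.prems(3) T
    by (auto simp: state_after_def alg1_def alg1_element_def split: if_splits)
  show ?case
  proof (cases "?accept T1")
    case True
    with step have S: "S1 = insert u T1" "S2 = T2" by auto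
    have "threshold_set f k ?\<theta> (insert u (set us)) (insert u T1)"
      using True u by (intro threshold_set_add[OF assms(1) IH(1)]) auto
    \<comment> \<open>An element taken by the first candidate never reaches the second, whose
      arrival set is unchanged.\<close>
    moreover have "insert u (set us) - insert u T1 = set us - T1" using u by auto
    ultimately show ?thesis using IH(2) S by simp
  next
    case False
    with step have S: "S1 = T1" by (auto split: if_splits)
    have diff: "insert u (set us) - T1 = insert u (set us - T1)" using u T1 by auto
    have "threshold_set f k ?\<theta> (insert u (set us - T1)) S2"
    proof (cases "?accept T2")
      case True
      with step False have "S2 = insert u T2" by (auto split: if_splits)
      moreover have "threshold_set f k ?\<theta> (insert u (set us - T1)) (insert u T2)"
        using True u by (intro threshold_set_add[OF assms(1) IH(2)]) auto
      ultimately show ?thesis by simp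
    next
      case not2: False
      with step False have "S2 = T2" by (auto split: if_splits)
      then show ?thesis using threshold_set_reject[OF IH(2) not2] by simp
    qed
    then show ?thesis using threshold_set_reject[OF IH(1) False] S diff by simp
  qed
qed

text \<open>This is the part of the analysis free of oracle programs; \<open>m\<close> stands for
  the value of the returned set.\<close>

lemma threshold_sets_approx:
  assumes "submodular_on N f" "\<And>S. S \<subseteq> N \<Longrightarrow> 0 \<le> f S" "finite N" "1 \<le> k"
    and "threshold_set f k (v / 6 / real k) N S1" "threshold_set f k (v / 6 / real k) (N - S1) S2"
    and "1 / 2 * Max (f ` Pow S1) \<le> f S3"
    and "0 < \<alpha>" "\<alpha> \<le> 1" "\<alpha> * opt_value N f k \<le> v" "v \<le> opt_value N f k"
    and "f S1 \<le> m" "f S2 \<le> m" "f S3 \<le> m"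
  shows "\<alpha> / 6 * opt_value N f k \<le> m"
proof (cases "card S1 < k \<and> card S2 < k")
  case False
  \<comment> \<open>A full candidate has \<open>k\<close> elements, and \<open>k\<close> times the
    threshold is \<open>v / 6\<close>.\<close>
  then have "v / 6 \<le> f S1 \<or> v / 6 \<le> f S2"
    using assms(4,5,6) unfolding threshold_set_def by auto
  then show ?thesis using assms by auto
next
  case True
  obtain Q where Q: "Q \<subseteq> N" "card Q \<le> k" "f Q = opt_value N f k"
    using opt_value_attained[OF assms(3)] by metis
  have fin: "finite Q" using Q assms finite_subset by blast
  have S: "S1 \<subseteq> N" "S2 \<subseteq> N - S1" using assms(5,6) unfolding threshold_set_def by auto
  have opt: "0 \<le> opt_value N f k" using assms(2)[OF Q(1)] Q(3) by simp
  \<comment> \<open>Makes the threshold non-negative, as \<open>threshold_set_union_le\<close>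
    requires.\<close>
  then have v: "0 \<le> v" using assms(8,10) by (smt (verit) mult_nonneg_nonneg)
  have 1: "f (S1 \<union> Q) \<le> f S1 + real k * (v / 6 / real k)"
    using True Q fin v assms by (intro threshold_set_union_le[OF assms(1,5)]) auto
  have "card (Q - S1) \<le> k" using Q fin card_mono[of Q "Q - S1"] by force
  then have 2: "f (S2 \<union> (Q - S1)) \<le> f S2 + real k * (v / 6 / real k)"
    using True Q fin v assms by (intro threshold_set_union_le[OF assms(1,6)]) auto
  have 3: "f ((S1 \<union> Q) \<union> (S2 \<union> (Q - S1))) + f ((S1 \<union> Q) \<inter> (S2 \<union> (Q - S1)))
      \<le> f (S1 \<union> Q) + f (S2 \<union> (Q - S1))"
    using Q S by (intro submodular_onD[OF assms(1)]) auto
  have 4: "(S1 \<union> Q) \<inter> (S2 \<union> (Q - S1)) = Q - S1" using S by auto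
  have 5: "0 \<le> f ((S1 \<union> Q) \<union> (S2 \<union> (Q - S1)))" using Q S by (intro assms(2)) auto
  have 6: "f ((Q \<inter> S1) \<union> (Q - S1)) + f ((Q \<inter> S1) \<inter> (Q - S1)) \<le> f (Q \<inter> S1) + f (Q - S1)"
    using Q S by (intro submodular_onD[OF assms(1)]) auto
  have 7: "(Q \<inter> S1) \<union> (Q - S1) = Q" by auto
  have 8: "0 \<le> f ((Q \<inter> S1) \<inter> (Q - S1))" using Q S by (intro assms(2)) auto
  have "finite S1" using S assms finite_subset by blast
  then have "f (Q \<inter> S1) \<le> Max (f ` Pow S1)" by (intro Max_ge) auto
  then have 9: "f (Q \<inter> S1) \<le> 2 * f S3" using assms(7) by simp
  have "real k * (v / 6 / real k) = v / 6" using assms(4) by simp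
  then have "opt_value N f k \<le> 4 * m + v / 3"
    using 1 2 3 5 6 8 9 Q(3) assms(12-14) unfolding 4 7 by linarith
  \<comment> \<open>With \<open>v \<le> OPT\<close> the previous bound becomes
    \<open>2/3 * OPT \<le> 4 * m\<close>. The factor \<open>\<alpha>\<close> is lost only when a
    candidate is full.\<close>
  then have "opt_value N f k / 6 \<le> m" using assms(11) by linarith
  moreover have "\<alpha> * opt_value N f k \<le> 1 * opt_value N f k"
    using assms(9) opt by (intro mult_right_mono)
  ultimately show ?thesis by simp
qed

text \<open>At most two marginals are evaluated, at two queries each.\<close>

lemma queries_alg1_element_le: "queries f (alg1_element k \<tau> u s) \<le> 4"
  by (cases s) (auto simp: alg1_element_def)

text \<open>\<open>C\<close> is chosen before every input, which is the meaning of O(1). The cost of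
  \<open>U\<close> is left open, so the queries after the stream are bounded relative to those of
  \<open>U\<close> on the final \<open>S1\<close>.\<close>

theorem theorem1:
  "\<exists>C::nat. \<forall>(us :: 'a list) (f :: 'a set \<Rightarrow> real) (k :: nat) (v :: real) (\<alpha> :: real)
      (U :: 'a set \<Rightarrow> ('a, 'a set) oracle_prog).
     distinct us \<and> (\<forall>S. S \<subseteq> set us \<longrightarrow> 0 \<le> f S) \<and> submodular_on (set us) f \<and> k \<ge> 1 \<and>
     half_approx_unconstrained (set us) f U \<and>
     0 < \<alpha> \<and> \<alpha> \<le> 1 \<and>
     \<alpha> * opt_value (set us) f k \<le> v \<and> v \<le> opt_value (set us) f k
     \<longrightarrow>
     (\<exists>ps S. run (alg1 U k v) f us ps S \<and>
        S \<subseteq> set us \<and> card S \<le> k \<and> f S \<ge> \<alpha> / 6 * opt_value (set us) f k \<and>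
        length ps = 1 \<and>
        (\<forall>(S1, S2) \<in> visited_states (alg1 U k v) f us ps.
           S1 \<union> S2 \<subseteq> set us \<and> card S1 \<le> k \<and> card S2 \<le> k \<and> card (S1 \<union> S2) \<le> 2 * k) \<and>
        (\<forall>i < length us. element_queries (alg1 U k v) f us ps i \<le> C) \<and>
        end_queries (alg1 U k v) f us ps
          \<le> queries f (U (fst (state_after (alg1 U k v) f us (start (alg1 U k v))))) + C)"
\<comment> \<open>The value 4 bounds the queries per arrival and also covers the three queries that
  compare the candidates at the end.\<close>
proof (intro exI[of _ 4] allI impI, elim conjE)
  fix us :: "'a list" and f :: "'a set \<Rightarrow> real" and k :: nat and v \<alpha> :: real
    and U :: "'a set \<Rightarrow> ('a, 'a set) oracle_prog"
  assume dist: "distinct us" and nonneg: "\<forall>S. S \<subseteq> set us \<longrightarrow> 0 \<le> f S"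
    and sub: "submodular_on (set us) f" and k: "k \<ge> 1"
    and U: "half_approx_unconstrained (set us) f U"
    and \<alpha>: "0 < \<alpha>" "\<alpha> \<le> 1"
    and v: "\<alpha> * opt_value (set us) f k \<le> v" "v \<le> opt_value (set us) f k"
  let ?A = "alg1 U k v"
  let ?\<theta> = "v / 6 / real k"
  have start: "start ?A = ({}, {})" by (simp add: alg1_def)
  \<comment> \<open>Stated for all prefixes because the memory bound concerns every intermediate
    state.\<close>
  have inv: "threshold_set f k ?\<theta> (set (take i us)) T1 \<and>
      threshold_set f k ?\<theta> (set (take i us) - T1) T2"
    if "state_after ?A f (take i us) ({}, {}) = (T1, T2)" for i T1 T2
    using that sub nonneg dist
    by (intro alg1_state_invariant[where N = "set us"]) (auto dest: in_set_takeD)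
  obtain S1 S2 where S: "state_after ?A f us ({}, {}) = (S1, S2)" by fastforce
  have thr: "threshold_set f k ?\<theta> (set us) S1" "threshold_set f k ?\<theta> (set us - S1) S2"
    using inv[of "length us" S1 S2] S by auto
  then have S12: "S1 \<subseteq> set us" "S2 \<subseteq> set us" "card S1 \<le> k" "card S2 \<le> k"
    unfolding threshold_set_def by auto
  define S3 where "S3 = result f (U S1)"
  have S3: "S3 \<subseteq> S1" "1 / 2 * Max (f ` Pow S1) \<le> f S3"
    using U S12 unfolding half_approx_unconstrained_def S3_def by auto
  have "card S3 \<le> k"
    using S12 S3 card_mono[of S1 S3] finite_subset[of S1 "set us"] by auto
  \<comment> \<open>Repeats the tie-breaking order of \<open>alg1_end\<close>.\<close>
  define R where "R = (if f S2 \<le> f S1 \<and> f S3 \<le> f S1 then S1 else if f S3 \<le> f S2 then S2 else S3)"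
  have max: "f S1 \<le> f R" "f S2 \<le> f R" "f S3 \<le> f R" by (auto simp: R_def)
  have halt: "result f (on_end ?A (state_after ?A f us ({}, {}))) = Inr R"
    unfolding S by (simp add: alg1_def alg1_end_def R_def S3_def)
  have run: "run ?A f us [({}, {})] R"
    unfolding run_def start by (rule run_from.halt[OF halt])
  have R: "R \<subseteq> set us" "card R \<le> k"
    using S12 S3 \<open>card S3 \<le> k\<close> by (auto simp: R_def)
  have ratio: "\<alpha> / 6 * opt_value (set us) f k \<le> f R"
    using nonneg by (intro threshold_sets_approx[OF sub _ _ k thr S3(2) \<alpha> v max]) auto
  have mem: "\<forall>(T1, T2) \<in> visited_states ?A f us [({}, {})].
      T1 \<union> T2 \<subseteq> set us \<and> card T1 \<le> k \<and> card T2 \<le> k \<and> card (T1 \<union> T2) \<le> 2 * k"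
  proof (intro ballI, clarify)
    fix T1 T2 assume visited: "(T1, T2) \<in> visited_states ?A f us [({}, {})]"
    obtain i where "state_after ?A f (take i us) ({}, {}) = (T1, T2)"
      using visited unfolding visited_states_def by auto
    from inv[OF this] have "T1 \<subseteq> set (take i us)" "T2 \<subseteq> set (take i us)" "card T1 \<le> k" "card T2 \<le> k"
      unfolding threshold_set_def by auto
    then show "T1 \<union> T2 \<subseteq> set us \<and> card T1 \<le> k \<and> card T2 \<le> k \<and> card (T1 \<union> T2) \<le> 2 * k"
      using card_Un_le[of T1 T2] set_take_subset[of i us] by auto
  qed
  have elem: "\<forall>i < length us. element_queries ?A f us [({}, {})] i \<le> 4"
    by (simp add: element_queries_def alg1_def queries_alg1_element_le)
  have fin: "end_queries ?A f us [({}, {})]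
      \<le> queries f (U (fst (state_after ?A f us (start ?A)))) + 4"
    unfolding end_queries_def start by (simp add: S) (simp add: alg1_def alg1_end_def)
  show "\<exists>ps S. run ?A f us ps S \<and> S \<subseteq> set us \<and> card S \<le> k \<and>
      f S \<ge> \<alpha> / 6 * opt_value (set us) f k \<and> length ps = 1 \<and>
      (\<forall>(S1, S2) \<in> visited_states ?A f us ps.
         S1 \<union> S2 \<subseteq> set us \<and> card S1 \<le> k \<and> card S2 \<le> k \<and> card (S1 \<union> S2) \<le> 2 * k) \<and>
      (\<forall>i < length us. element_queries ?A f us ps i \<le> 4) \<and>
      end_queries ?A f us ps \<le> queries f (U (fst (state_after ?A f us (start ?A)))) + 4"
    by (intro exI[of _ "[({}, {})]"] exI[of _ R] conjI run R ratio mem elem fin) simp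
qed

end
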